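(* Let $L$ be a BCF lattice. Then the dimension monoid $\operatorname{Dim}L$ is a primitive monoid.
   Context: A partially ordered set (in particular a lattice) is BCF if it has no infinite bounded chain. Lattices are not assumed to be bounded. For a lattice $L$, the dimension monoid $\operatorname{Dim}L$ is the commutative monoid defined by generators $\Delta(a,b)$ (for $a\leq b$ in $L$) and the relations: (D0) $\Delta(a,a)=0$ for all $a\in L$; (D1) $\Delta(a,c)=\Delta(a,b)+\Delta(b,c)$ for all $a\leq b\leq c$ in $L$; (D2) $\Delta(a,a\vee b)=\Delta(a\wedge b,b)$ for all $a,b\in L$. Let $M$ be a commutative monoid. Its algebraic preordering is defined by $x\leq y$ iff there is $z\in M$ with $x+z=y$. $M$ is a refinement monoid if whenever $a_0+a_1=b_0+b_1$ in $M$, there are $c_{ij}\in M$ ($i,j<2$) such that $a_i=c_{i0}+c_{i1}$ and $b_i=c_{0i}+c_{1i}$ for all $i<2$. An element $p\in M$ is pseudo-indecomposable if $x+y=p$ implies $x=p$ or $y=p$, for all $x,y\in M$. $M$ is primitive if it is a refinement monoid, its algebraic preordering is antisymmetric, and $M$ is generated, as a monoid, by the set of all its nonzero pseudo-indecomposable elements. *)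

theory Defs
  imports "HOL-Library.Multiset" "HOL-Library.Interval"
begin

text \<open>Chains are arbitrary totally ordered subsets; bounded means bounded both below and above.\<close>

definition bcf :: "'a::order itself \<Rightarrow> bool" where
  "bcf _ \<longleftrightarrow>
    (\<nexists>C :: 'a set. Complete_Partial_Order.chain (\<le>) C \<and> infinite C \<and> bdd_below C \<and> bdd_above C)"

text \<open>The elements of \<^typ>\<open>'a interval\<close> are exactly the pairs \<open>(a, b)\<close> with \<open>a \<le> b\<close>, and finite
  multisets of them form the free commutative monoid on these generators. The term
  \<open>Interval (a, b)\<close> is meaningful only for \<open>a \<le> b\<close>, hence the side conditions.\<close>

inductive dim_cong :: "'a::lattice interval multiset \<Rightarrow> 'a interval multiset \<Rightarrow> bool" where
  dim_cong_refl: "dim_cong X X"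
| dim_cong_sym: "dim_cong X Y \<Longrightarrow> dim_cong Y X"
| dim_cong_trans: "dim_cong X Y \<Longrightarrow> dim_cong Y Z \<Longrightarrow> dim_cong X Z"
| dim_cong_add: "dim_cong X Y \<Longrightarrow> dim_cong X' Y' \<Longrightarrow> dim_cong (X + X') (Y + Y')"
| dim_cong_D0: "dim_cong {#Interval (a, a)#} {#}"
| dim_cong_D1: "a \<le> b \<Longrightarrow> b \<le> c \<Longrightarrow>
    dim_cong {#Interval (a, c)#} ({#Interval (a, b)#} + {#Interval (b, c)#})"
| dim_cong_D2: "dim_cong {#Interval (a, sup a b)#} {#Interval (inf a b, b)#}"

quotient_type (overloaded) 'a dim = "'a::lattice interval multiset" / dim_cong
  by (intro equivpI reflpI sympI transpI) (blast intro: dim_cong.intros)+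

instantiation dim :: (lattice) comm_monoid_add
begin

lift_definition zero_dim :: "'a dim" is "{#}" .

lift_definition plus_dim :: "'a dim \<Rightarrow> 'a dim \<Rightarrow> 'a dim" is "(+)"
  by (rule dim_cong_add)

instance
  by standard (transfer, simp add: ac_simps dim_cong_refl)+

end

lift_definition Delta :: "'a::lattice \<Rightarrow> 'a \<Rightarrow> 'a dim" is "\<lambda>a b. {#Interval (a, b)#}" .

lemma Delta_D0: "Delta a a = 0"
  by transfer (rule dim_cong_D0)

lemma Delta_D1: "a \<le> b \<Longrightarrow> b \<le> c \<Longrightarrow> Delta a c = Delta a b + Delta b c"
  by transfer (rule dim_cong_D1)

lemma Delta_D2: "Delta a (sup a b) = Delta (inf a b) b"
  by transfer (rule dim_cong_D2)

lemma dim_universal: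
  fixes f :: "'a::lattice \<Rightarrow> 'a \<Rightarrow> 'm::comm_monoid_add"
  assumes D0: "\<And>a. f a a = 0"
    and D1: "\<And>a b c. a \<le> b \<Longrightarrow> b \<le> c \<Longrightarrow> f a c = f a b + f b c"
    and D2: "\<And>a b. f a (sup a b) = f (inf a b) b"
  shows "\<exists>!h :: 'a dim \<Rightarrow> 'm. h 0 = 0 \<and> (\<forall>x y. h (x + y) = h x + h y) \<and>
    (\<forall>a b. a \<le> b \<longrightarrow> h (Delta a b) = f a b)"
proof -
  define F where "F X = (\<Sum>i\<in>#X. f (lower i) (upper i))" for X
  have lu [simp]: "lower (Interval (a, b)) = a" "upper (Interval (a, b)) = b" if "a \<le> b" for a b :: 'a
    using that by (simp_all add: lower.rep_eq upper.rep_eq Interval_inverse)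
  have F_cong: "F X = F Y" if "dim_cong X Y" for X Y
    using that
  proof induction
    case (dim_cong_D1 a b c)
    then show ?case using D1[of a b c] by (simp add: F_def order_trans[of a b c] add.commute)
  qed (simp_all add: F_def D0 D2)
  define h where "h x = F (rep_dim x)" for x
  have h_abs: "h (abs_dim X) = F X" for X
    unfolding h_def by (rule F_cong) (metis Quotient3_dim rep_abs_rsp_left dim_cong_refl)
  have abs_add: "abs_dim X + abs_dim Y = abs_dim (X + Y)" for X Y :: "'a interval multiset"
    by (simp add: plus_dim.abs_eq)
  have abs_Delta: "Delta a b = abs_dim {#Interval (a, b)#}" for a b :: 'a
    by (rule Delta.abs_eq)
  have h_add: "h (x + y) = h x + h y" for x y
    by (induction x; induction y) (simp add: abs_add h_abs F_def)
  have h_0: "h 0 = 0" and h_Delta: "\<And>a b. a \<le> b \<Longrightarrow> h (Delta a b) = f a b"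
    by (simp_all add: zero_dim_def abs_Delta h_abs F_def)
  have uniq: "g = h" if g: "g 0 = 0" "\<forall>x y. g (x + y) = g x + g y"
    "\<forall>a b. a \<le> b \<longrightarrow> g (Delta a b) = f a b" for g
  proof
    fix x show "g x = h x"
    proof (induction x)
      case (1 X)
      have "g (abs_dim X) = F X"
      proof (induction X)
        case empty
        then show ?case using g(1) by (simp add: zero_dim_def F_def)
      next
        case (add i X)
        have i: "i = Interval (lower i, upper i)"
          by (simp add: lower.rep_eq upper.rep_eq bounds_of_interval_inverse)
        have "abs_dim (add_mset i X) = Delta (lower i) (upper i) + abs_dim X"
          using i by (simp add: abs_Delta abs_add)
        then show ?case
          using g(2,3) add by (simp add: F_def)
      qed
      then show ?case by (simp add: h_abs)
    qed
  qed
  show ?thesis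
    by (rule ex1I[of _ h]) (use h_add h_0 h_Delta in blast, rule uniq, blast+)
qed

definition alg_le :: "'m::comm_monoid_add \<Rightarrow> 'm \<Rightarrow> bool" where
  "alg_le x y \<longleftrightarrow> (\<exists>z. x + z = y)"

definition refinement_monoid :: "'m::comm_monoid_add itself \<Rightarrow> bool" where
  "refinement_monoid _ \<longleftrightarrow>
    (\<forall>a0 a1 b0 b1 :: 'm. a0 + a1 = b0 + b1 \<longrightarrow>
      (\<exists>c00 c01 c10 c11. a0 = c00 + c01 \<and> a1 = c10 + c11 \<and> b0 = c00 + c10 \<and> b1 = c01 + c11))"

definition pseudo_indecomposable :: "'m::comm_monoid_add \<Rightarrow> bool" where
  "pseudo_indecomposable p \<longleftrightarrow> (\<forall>x y. x + y = p \<longrightarrow> x = p \<or> y = p)"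

definition submonoid :: "'m::comm_monoid_add set \<Rightarrow> bool" where
  "submonoid N \<longleftrightarrow> 0 \<in> N \<and> (\<forall>x\<in>N. \<forall>y\<in>N. x + y \<in> N)"

text \<open>\<open>submonoid hull S\<close> is the submonoid generated by \<open>S\<close>.\<close>

definition primitive_monoid :: "'m::comm_monoid_add itself \<Rightarrow> bool" where
  "primitive_monoid _ \<longleftrightarrow>
    refinement_monoid TYPE('m) \<and>
    antisymp (alg_le :: 'm \<Rightarrow> 'm \<Rightarrow> bool) \<and>
    submonoid hull {p :: 'm. p \<noteq> 0 \<and> pseudo_indecomposable p} = UNIV"

end

theory Submission imports Defs begin

text \<open>
  In a BCF lattice every interval has a finite maximal chain, so \<open>Dim L\<close> is generated by the
  elements \<open>\<Delta>(a, b)\<close> with \<open>b\<close> covering \<open>a\<close>. The point is that these generators satisfy no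
  relations beyond absorptions \<open>p + q = q\<close> between two of them: whenever two finite sums of
  generators are equal, the two multisets of summands become literally equal after each has been
  enlarged by elements that it absorbs, each through a single one of its members
  (\<open>absorb_eq\<close>). Any monoid with such a generating set is primitive
  (\<open>primitive_monoid_if_absorption_presented\<close>): after the enlargement, an equation is an equation
  in a free commutative monoid, where refinement and cancellation are available.

  To see that \<open>Dim L\<close> has this presentation, one sends an interval to the multiset of the
  dimensions of the steps of a maximal chain, and checks the defining relations of \<open>Dim L\<close> up to \<open>absorb_eq\<close>.
  The crucial observation concerns a covering pair \<open>a \<prec> d\<close> and an element \<open>e \<ge> a\<close> with
  \<open>d \<not>\<le> e\<close>. If \<open>u\<close> climbs a maximal chain from \<open>e\<close> to \<open>e \<squnion> d\<close>, then \<open>u \<sqinter> d = a\<close> and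
  \<open>u \<squnion> d = e \<squnion> d\<close> until the top is reached, so all the intervals \<open>[u, e \<squnion> d]\<close> have the same
  dimension \<open>\<Delta>(a, d)\<close>. Hence the last step of the chain has dimension \<open>\<Delta>(a, d)\<close> and every other
  step is absorbed by it (\<open>transpose_up\<close>, with its dual \<open>transpose_down\<close>). From this, a
  Jordan-Hoelder argument shows that the choice of the maximal chain is immaterial
  (\<open>cover_path_unique\<close>), and an induction along the chain yields (D2)
  (\<open>cover_path_transpose\<close>).
\<close>

section \<open>Monoids presented by absorption relations\<close>

definition absorbed_in :: "'m::comm_monoid_add multiset \<Rightarrow> 'm multiset \<Rightarrow> bool" where
  "absorbed_in P X \<longleftrightarrow> (\<forall>p\<in>#P. \<exists>x\<in>#X. p + x = x)"

text \<open>This is the congruence on the free commutative monoid that is generated by the pairs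
  \<open>({#p, q#}, {#q#})\<close> with \<open>p + q = q\<close>: insertions of absorbed elements commute with each other,
  so two related multisets have a common enlargement, and one round of insertions suffices
  because absorption is transitive.\<close>

definition absorb_eq :: "'m::comm_monoid_add multiset \<Rightarrow> 'm multiset \<Rightarrow> bool" where
  "absorb_eq X Y \<longleftrightarrow> (\<exists>P Q. X + P = Y + Q \<and> absorbed_in P X \<and> absorbed_in Q Y)"

lemma absorbed_in_empty [simp]: "absorbed_in {#} X"
  by (simp add: absorbed_in_def)

lemma absorbed_in_union: "absorbed_in (P + Q) X \<longleftrightarrow> absorbed_in P X \<and> absorbed_in Q X"
  by (auto simp: absorbed_in_def)

lemma absorbed_in_mono: "absorbed_in P X \<Longrightarrow> X \<subseteq># Y \<Longrightarrow> absorbed_in P Y"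
  unfolding absorbed_in_def by (meson mset_subset_eqD)

lemma absorption_trans:
  fixes x y z :: "'m::comm_monoid_add"
  assumes "x + y = y" "y + z = z" shows "x + z = z"
  by (metis assms add.assoc)

lemma absorbed_in_trans:
  assumes P: "absorbed_in P (X + Q)" and Q: "absorbed_in Q X"
  shows "absorbed_in P X"
  unfolding absorbed_in_def
proof
  fix p assume "p \<in># P"
  then obtain y where y: "y \<in># X + Q" "p + y = y"
    using P by (auto simp: absorbed_in_def)
  show "\<exists>x\<in>#X. p + x = x"
  proof (cases "y \<in># X")
    case False
    then obtain x where "x \<in># X" "y + x = x"
      using y(1) Q by (auto simp: absorbed_in_def)
    then show ?thesis using y(2) absorption_trans by blast
  qed (use y in blast)
qed

lemma sum_mset_absorbed: "absorbed_in P X \<Longrightarrow> \<Sum>\<^sub># (X + P) = \<Sum>\<^sub># X"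
proof (induction P)
  case (add p P)
  then obtain x X' where x: "p + x = x" "X = add_mset x X'"
    by (auto simp: absorbed_in_def dest: multi_member_split)
  have "\<Sum>\<^sub># (X + add_mset p P) = p + \<Sum>\<^sub># (X + P)"
    by (simp add: ac_simps)
  also have "\<dots> = p + \<Sum>\<^sub># X"
    using add by (simp add: absorbed_in_def)
  also have "\<dots> = (p + x) + \<Sum>\<^sub># X'"
    by (simp add: x(2) ac_simps)
  finally show ?case by (simp add: x)
qed simp

lemma absorb_eq_sum: "absorb_eq X Y \<Longrightarrow> \<Sum>\<^sub># X = \<Sum>\<^sub># Y"
  unfolding absorb_eq_def by (metis sum_mset_absorbed)

lemma absorb_eq_refl [simp]: "absorb_eq X X"
  unfolding absorb_eq_def by (metis absorbed_in_empty)

lemma absorb_eq_sym: "absorb_eq X Y \<Longrightarrow> absorb_eq Y X"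
  unfolding absorb_eq_def by metis

lemma absorb_eq_trans [trans]:
  assumes "absorb_eq X Y" "absorb_eq Y Z"
  shows "absorb_eq X Z"
proof -
  obtain P Q where PQ: "X + P = Y + Q" "absorbed_in P X" "absorbed_in Q Y"
    using assms(1) by (auto simp: absorb_eq_def)
  obtain R T where RT: "Y + R = Z + T" "absorbed_in R Y" "absorbed_in T Z"
    using assms(2) by (auto simp: absorb_eq_def)
  have "absorbed_in R (X + P)"
    using RT(2) by (rule absorbed_in_mono) (simp add: PQ(1))
  then have R: "absorbed_in R X"
    using PQ(2) by (rule absorbed_in_trans)
  have "absorbed_in Q (Z + T)"
    using PQ(3) by (rule absorbed_in_mono) (simp flip: RT(1))
  then have Q: "absorbed_in Q Z"
    using RT(3) by (rule absorbed_in_trans)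
  have "X + (P + R) = (X + P) + R"
    by (simp add: add.assoc)
  also have "\<dots> = (Y + R) + Q"
    unfolding PQ(1) by (simp add: ac_simps)
  also have "\<dots> = Z + (T + Q)"
    unfolding RT(1) by (simp add: ac_simps)
  finally show ?thesis
    unfolding absorb_eq_def using PQ(2) R RT(3) Q absorbed_in_union by blast
qed

lemma absorb_eq_add:
  assumes "absorb_eq X Y" "absorb_eq X' Y'"
  shows "absorb_eq (X + X') (Y + Y')"
proof -
  obtain P Q where PQ: "X + P = Y + Q" "absorbed_in P X" "absorbed_in Q Y"
    using assms(1) by (auto simp: absorb_eq_def)
  obtain R T where RT: "X' + R = Y' + T" "absorbed_in R X'" "absorbed_in T Y'"
    using assms(2) by (auto simp: absorb_eq_def)
  have "(X + X') + (P + R) = (X + P) + (X' + R)" by (simp add: ac_simps)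
  also have "\<dots> = (Y + Y') + (Q + T)" unfolding PQ(1) RT(1) by (simp add: ac_simps)
  finally have "(X + X') + (P + R) = (Y + Y') + (Q + T)" .
  moreover have "absorbed_in (P + R) (X + X')" "absorbed_in (Q + T) (Y + Y')"
    using PQ RT by (auto simp: absorbed_in_union intro: absorbed_in_mono)
  ultimately show ?thesis unfolding absorb_eq_def by blast
qed

lemma absorb_eq_add_mset: "absorb_eq X Y \<Longrightarrow> absorb_eq (add_mset p X) (add_mset p Y)"
  using absorb_eq_add[OF absorb_eq_refl[of "{#p#}"], of X Y] by simp

lemma absorb_eq_insert: "p + q = q \<Longrightarrow> absorb_eq (add_mset p (add_mset q X)) (add_mset q X)"
  unfolding absorb_eq_def
  by (rule exI[of _ "{#}"], rule exI[of _ "{#p#}"]) (auto simp: absorbed_in_def)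

lemma multiset_refinement:
  fixes A B C D :: "'b multiset"
  assumes "A + B = C + D"
  obtains U V W T where "A = U + V" "B = W + T" "C = U + W" "D = V + T"
proof
  have count: "count A x + count B x = count C x + count D x" for x
    using arg_cong[OF assms, of "\<lambda>M. count M x"] by simp
  show "A = A \<inter># C + (A - C)" "C = A \<inter># C + (C - A)"
    by (auto intro!: multiset_eqI)
  show "B = (C - A) + (B - (C - A))"
  proof (rule multiset_eqI)
    fix x show "count B x = count ((C - A) + (B - (C - A))) x"
      using count[of x] by simp
  qed
  show "D = (A - C) + (B - (C - A))"
  proof (rule multiset_eqI)
    fix x show "count D x = count ((A - C) + (B - (C - A))) x"
      using count[of x] by simp
  qed
qed

lemma absorbed_in_split:
  assumes "absorbed_in P (X + Y)"
  obtains P1 P2 where "P = P1 + P2" "absorbed_in P1 X" "absorbed_in P2 Y"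
proof
  let ?A = "\<lambda>p. \<exists>x\<in>#X. p + x = x"
  show "P = filter_mset ?A P + filter_mset (\<lambda>p. \<not> ?A p) P"
    by (rule multiset_partition)
  show "absorbed_in (filter_mset ?A P) X" "absorbed_in (filter_mset (\<lambda>p. \<not> ?A p) P) Y"
    using assms by (auto simp: absorbed_in_def)
qed

text \<open>Each of the three clauses of primitivity is read off from the free commutative monoid, where
  the equation holds literally after both sides have been enlarged by absorbed elements. For
  refinement, an inserted element is attributed to the summand that absorbs it, and thus does
  not change the value of that summand. For antisymmetry, cancelling \<open>X\<close> in a common
  enlargement of \<open>X + U + V\<close> and \<open>X\<close> shows that \<open>U\<close> is absorbed in \<open>X\<close>. For
  pseudo-indecomposability, an enlargement of \<open>{#p#}\<close> consists of \<open>p\<close> and elements absorbed by \<open>p\<close>, and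
  an element that absorbs \<open>p\<close> and is absorbed by \<open>p\<close> equals \<open>p\<close>.\<close>

theorem primitive_monoid_if_absorption_presented:
  fixes S :: "'m::comm_monoid_add set"
  assumes gen: "\<And>x. \<exists>X. set_mset X \<subseteq> S \<and> x = \<Sum>\<^sub># X"
    and rel: "\<And>X Y. set_mset X \<subseteq> S \<Longrightarrow> set_mset Y \<subseteq> S \<Longrightarrow> \<Sum>\<^sub># X = \<Sum>\<^sub># Y \<Longrightarrow> absorb_eq X Y"
  shows "primitive_monoid TYPE('m)"
  unfolding primitive_monoid_def
proof (intro conjI)
  show "refinement_monoid TYPE('m)"
    unfolding refinement_monoid_def
  proof (intro allI impI)
    fix a0 a1 b0 b1 :: 'm
    assume eq: "a0 + a1 = b0 + b1"
    obtain X Y Z W where S: "set_mset X \<subseteq> S" "set_mset Y \<subseteq> S" "set_mset Z \<subseteq> S" "set_mset W \<subseteq> S"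
      and sums: "a0 = \<Sum>\<^sub># X" "a1 = \<Sum>\<^sub># Y" "b0 = \<Sum>\<^sub># Z" "b1 = \<Sum>\<^sub># W"
      by (meson gen)
    have "absorb_eq (X + Y) (Z + W)"
      using S eq by (intro rel) (auto simp: sums)
    then obtain P Q where PQ: "X + Y + P = Z + W + Q"
      "absorbed_in P (X + Y)" "absorbed_in Q (Z + W)"
      by (auto simp: absorb_eq_def)
    obtain P0 P1 where P: "P = P0 + P1" "absorbed_in P0 X" "absorbed_in P1 Y"
      using absorbed_in_split[OF PQ(2)] .
    obtain Q0 Q1 where Q: "Q = Q0 + Q1" "absorbed_in Q0 Z" "absorbed_in Q1 W"
      using absorbed_in_split[OF PQ(3)] .
    have "(X + P0) + (Y + P1) = (Z + Q0) + (W + Q1)"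
      using PQ(1) by (simp add: P(1) Q(1) ac_simps)
    then obtain C00 C01 C10 C11 where C: "X + P0 = C00 + C01" "Y + P1 = C10 + C11"
      "Z + Q0 = C00 + C10" "W + Q1 = C01 + C11"
      by (rule multiset_refinement)
    have "a0 = \<Sum>\<^sub># C00 + \<Sum>\<^sub># C01" "a1 = \<Sum>\<^sub># C10 + \<Sum>\<^sub># C11"
      "b0 = \<Sum>\<^sub># C00 + \<Sum>\<^sub># C10" "b1 = \<Sum>\<^sub># C01 + \<Sum>\<^sub># C11"
      using P Q C sums by (metis sum_mset_absorbed sum_mset.union)+
    then show "\<exists>c00 c01 c10 c11. a0 = c00 + c01 \<and> a1 = c10 + c11 \<and> b0 = c00 + c10 \<and> b1 = c01 + c11"
      by blast
  qed
next
  show "antisymp (alg_le :: 'm \<Rightarrow> 'm \<Rightarrow> bool)"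
  proof (rule antisympI)
    fix x y :: 'm
    assume "alg_le x y" "alg_le y x"
    then obtain u v where uv: "x + u = y" "y + v = x" by (auto simp: alg_le_def)
    obtain X U V where S: "set_mset X \<subseteq> S" "set_mset U \<subseteq> S" "set_mset V \<subseteq> S"
      and sums: "x = \<Sum>\<^sub># X" "u = \<Sum>\<^sub># U" "v = \<Sum>\<^sub># V"
      by (meson gen)
    have "absorb_eq (X + U + V) X"
      using S uv by (intro rel) (auto simp flip: sums)
    then obtain P Q where PQ: "X + U + V + P = X + Q" "absorbed_in Q X"
      by (auto simp: absorb_eq_def)
    have "Q = U + (V + P)" using PQ(1) by (simp add: add.assoc)
    then have "absorbed_in U X" using PQ(2) by (simp add: absorbed_in_union)
    then have "x + u = x" using sum_mset_absorbed sums by (metis sum_mset.union)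
    then show "x = y" using uv by simp
  qed
next
  have pseudo: "pseudo_indecomposable p" if "p \<in> S" for p
    unfolding pseudo_indecomposable_def
  proof (intro allI impI)
    fix x y assume xy: "x + y = p"
    obtain X Y where S: "set_mset X \<subseteq> S" "set_mset Y \<subseteq> S"
      and sums: "x = \<Sum>\<^sub># X" "y = \<Sum>\<^sub># Y"
      by (meson gen)
    have "absorb_eq (X + Y) {#p#}"
      using S xy that by (intro rel) (auto simp flip: sums)
    then obtain P Q where PQ: "X + Y + P = {#p#} + Q"
      "absorbed_in P (X + Y)" "absorbed_in Q {#p#}"
      by (auto simp: absorb_eq_def)
    have below: "q = p \<or> q + p = p" if "q \<in># X + Y" for q
    proof -
      have "q \<in># {#p#} + Q" using that by (metis PQ(1) union_iff)
      then show ?thesis using PQ(3) by (auto simp: absorbed_in_def)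
    qed
    have "p \<in># X + Y"
    proof (rule ccontr)
      assume notin: "p \<notin># X + Y"
      have "p \<in># X + Y + P" by (simp add: PQ(1))
      then obtain q where q: "q \<in># X + Y" "p + q = q"
        using notin PQ(2) by (auto simp: absorbed_in_def)
      then have "q = p" using below[OF q(1)] by (metis add.commute)
      then show False using q notin by simp
    qed
    moreover have "\<Sum>\<^sub># Z = p" if Z: "p \<in># Z" "Z \<subseteq># X + Y" for Z
    proof -
      obtain Z' where Z': "Z = {#p#} + Z'" using Z(1) by (auto dest: multi_member_split)
      have "{#p#} + Z' \<subseteq># {#p#} + Q"
        using Z(2) unfolding Z' by (metis PQ(1) mset_subset_eq_add_left subset_mset.order_trans)
      then have "Z' \<subseteq># Q" by simp
      then have "absorbed_in Z' {#p#}"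
        using PQ(3) by (meson absorbed_in_def mset_subset_eqD)
      then show ?thesis unfolding Z' by (simp only: sum_mset_absorbed sum_mset.singleton)
    qed
    ultimately show "x = p \<or> y = p"
      unfolding sums by (metis mset_subset_eq_add_left mset_subset_eq_add_right union_iff)
  qed
  show "submonoid hull {p :: 'm. p \<noteq> 0 \<and> pseudo_indecomposable p} = UNIV"
    unfolding hull_def
  proof (rule sym, rule UNIV_eq_I, rule InterI)
    fix x :: 'm and T
    assume "T \<in> {T. submonoid T \<and> {p :: 'm. p \<noteq> 0 \<and> pseudo_indecomposable p} \<subseteq> T}"
    then have T: "submonoid T" "{p :: 'm. p \<noteq> 0 \<and> pseudo_indecomposable p} \<subseteq> T"
      by blast+
    have "set_mset X \<subseteq> S \<Longrightarrow> \<Sum>\<^sub># X \<in> T" for X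
    proof (induction X)
      case empty
      then show ?case using T by (simp add: submonoid_def)
    next
      case (add p X)
      have "p \<in> T"
        using T pseudo[of p] add.prems by (cases "p = 0") (auto simp: submonoid_def)
      then show ?case using T add by (simp add: submonoid_def)
    qed
    then show "x \<in> T" using gen by metis
  qed
qed

section \<open>Maximal chains in BCF lattices\<close>

definition covers :: "'a::order \<Rightarrow> 'a \<Rightarrow> bool" where
  "covers a b \<longleftrightarrow> a < b \<and> (\<forall>c. a \<le> c \<longrightarrow> c \<le> b \<longrightarrow> c = a \<or> c = b)"

lemma bcf_wf_up:
  assumes "bcf TYPE('a::order)"
  shows "wf {(x, y :: 'a). y < x \<and> x \<le> b}"
proof (rule ccontr)
  assume "\<not> wf {(x, y :: 'a). y < x \<and> x \<le> b}"
  then obtain f :: "nat \<Rightarrow> 'a" where f: "\<And>i. f i < f (Suc i)" "\<And>i. f (Suc i) \<le> b"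
    by (auto simp: wf_iff_no_infinite_down_chain)
  have mono: "strict_mono f" using f(1) by (simp add: strict_mono_Suc_iff)
  have "infinite (range f)"
    using mono by (simp add: finite_image_iff strict_mono_imp_inj_on)
  moreover have "Complete_Partial_Order.chain (\<le>) (range f)"
    by (rule chainI) (metis mono imageE nle_le strict_mono_less_eq)
  moreover have "bdd_below (range f)"
    using mono by (auto intro!: bdd_belowI[of _ "f 0"] simp: strict_mono_less_eq)
  moreover have "bdd_above (range f)"
    using f by (auto intro!: bdd_aboveI[of _ b] intro: order.trans[OF less_imp_le])
  ultimately show False using assms unfolding bcf_def by blast
qed

lemma bcf_wf_down:
  assumes "bcf TYPE('a::order)"
  shows "wf {(x, y :: 'a). x < y \<and> a \<le> x}"
proof (rule ccontr)
  assume "\<not> wf {(x, y :: 'a). x < y \<and> a \<le> x}"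
  then obtain f :: "nat \<Rightarrow> 'a" where f: "\<And>i. f (Suc i) < f i" "\<And>i. a \<le> f (Suc i)"
    by (auto simp: wf_iff_no_infinite_down_chain)
  have less: "f j < f i" if "i < j" for i j
    using that by (induction j) (auto simp: less_Suc_eq intro: f(1) order.strict_trans[OF f(1)])
  have le: "f j \<le> f i" if "i \<le> j" for i j
    using that less by (metis le_neq_implies_less order.order_iff_strict)
  have "inj f" by (rule injI) (metis less less_irrefl nat_neq_iff)
  then have "infinite (range f)" by (simp add: finite_image_iff)
  moreover have "Complete_Partial_Order.chain (\<le>) (range f)"
    by (rule chainI) (metis le imageE nle_le)
  moreover have "bdd_above (range f)"
    using le by (auto intro!: bdd_aboveI[of _ "f 0"])
  moreover have "bdd_below (range f)"
    using f by (auto intro!: bdd_belowI[of _ a] intro: order.trans[OF _ less_imp_le])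
  ultimately show False using assms unfolding bcf_def by blast
qed

lemma bcf_cover_exists:
  assumes "bcf TYPE('a::order)" "(a :: 'a) < b"
  obtains c where "covers a c" "c \<le> b"
proof -
  have "b \<in> {c. a < c \<and> c \<le> b}" using assms(2) by simp
  then obtain c where c: "a < c" "c \<le> b"
    and min: "\<And>y. y < c \<Longrightarrow> a \<le> y \<Longrightarrow> \<not> (a < y \<and> y \<le> b)"
    using wfE_min[OF bcf_wf_down[OF assms(1), of a]]
    by (metis (no_types, lifting) case_prodI mem_Collect_eq)
  have "covers a c"
    unfolding covers_def
  proof (intro conjI allI impI)
    fix d assume d: "a \<le> d" "d \<le> c"
    show "d = a \<or> d = c"
      using min[of d] d c(2) by (metis order.order_iff_strict order.trans)
  qed (fact c(1))
  then show ?thesis using c(2) that by blast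
qed

text \<open>A maximal chain of \<open>[a, b]\<close>, recorded as the multiset of the dimensions of its steps.\<close>

inductive cover_path :: "'a::lattice \<Rightarrow> 'a \<Rightarrow> 'a dim multiset \<Rightarrow> bool" where
  Nil: "cover_path a a {#}"
| Cons: "covers a c \<Longrightarrow> cover_path c b X \<Longrightarrow> cover_path a b (add_mset (Delta a c) X)"

lemma covers_less: "covers a b \<Longrightarrow> a < b"
  by (simp add: covers_def)

lemma covers_le: "covers a b \<Longrightarrow> a \<le> b"
  by (rule less_imp_le) (rule covers_less)

lemma covers_between: "covers a b \<Longrightarrow> a \<le> c \<Longrightarrow> c \<le> b \<Longrightarrow> c = a \<or> c = b"
  by (simp add: covers_def)

lemma cover_path_le: "cover_path a b X \<Longrightarrow> a \<le> b"
  by (induction rule: cover_path.induct) (auto dest: covers_le)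

lemma cover_path_refl: "cover_path a a X \<Longrightarrow> X = {#}"
  by (erule cover_path.cases) (use covers_less cover_path_le in \<open>fastforce dest: leD\<close>)+

lemma cover_path_sum: "cover_path a b X \<Longrightarrow> \<Sum>\<^sub># X = Delta a b"
proof (induction rule: cover_path.induct)
  case (Cons a c b X)
  then show ?case
    using Delta_D1[of a c b] by (simp add: covers_le cover_path_le)
qed (simp add: Delta_D0)

lemma cover_path_steps:
  "cover_path a b X \<Longrightarrow> set_mset X \<subseteq> {Delta c d |c d. covers c d}"
  by (induction rule: cover_path.induct) auto

lemma cover_path_append: "cover_path a b X \<Longrightarrow> cover_path b c Y \<Longrightarrow> cover_path a c (X + Y)"
  by (induction rule: cover_path.induct) (auto intro: cover_path.Cons)

lemma cover_path_single: "covers a b \<Longrightarrow> cover_path a b {#Delta a b#}"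
  using cover_path.Cons cover_path.Nil by blast

text \<open>Maximal chains can also be climbed down from the top, which makes arguments by duality
  possible.\<close>

lemma cover_path_rev_induct [consumes 1, case_names Nil Snoc]:
  assumes "cover_path a b X"
    and Nil: "P a {#}"
    and Snoc: "\<And>u c X. cover_path a u X \<Longrightarrow> P u X \<Longrightarrow> covers u c \<Longrightarrow> P c (add_mset (Delta u c) X)"
  shows "P b X"
proof -
  have "P b (Y + X)" if "cover_path u b X" "cover_path a u Y" "P u Y" for u Y
    using that
  proof (induction u b X arbitrary: Y rule: cover_path.induct)
    case (Cons u c b X)
    have "cover_path a c (Y + {#Delta u c#})"
      using Cons cover_path_append cover_path_single by blast
    moreover have "P c (Y + {#Delta u c#})"
      using Snoc Cons by simp
    ultimately show ?case using Cons.IH[of "Y + {#Delta u c#}"] by simp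
  qed simp
  from this[OF assms(1) cover_path.Nil Nil] show ?thesis by simp
qed

lemma cover_path_exists:
  assumes "bcf TYPE('a::lattice)" "(a :: 'a) \<le> b"
  shows "\<exists>X. cover_path a b X"
  using bcf_wf_up[OF assms(1), of b] assms(2)
proof (induction a rule: wf_induct_rule)
  case (less a)
  show ?case
  proof (cases "a = b")
    case True
    then show ?thesis using cover_path.Nil by blast
  next
    case False
    then obtain c where "covers a c" "c \<le> b"
      using bcf_cover_exists[OF assms(1), of a b] less.prems by (auto simp: less_le)
    then show ?thesis
      using less.IH[of c] by (auto simp: covers_less intro: cover_path.Cons)
  qed
qed

section \<open>Maximal chains and the relations of the dimension monoid\<close>

text \<open>As long as a step \<open>[e, e1]\<close> does not reach the top \<open>e \<squnion> d\<close>, both \<open>[e, e \<squnion> d]\<close> and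
  \<open>[e1, e \<squnion> d]\<close> have dimension \<open>\<Delta>(a, d)\<close>, so \<open>\<Delta>(e, e1)\<close> is absorbed by \<open>\<Delta>(a, d)\<close>.\<close>

lemma transpose_up:
  assumes "covers a d" "cover_path e t X" "a \<le> e" "\<not> d \<le> e" "t = sup e d"
  shows "absorb_eq X {#Delta a d#}"
  using assms(2-)
proof (induction rule: cover_path.induct)
  case (Nil e)
  then show ?case by (metis sup_ge2)
next
  case (Cons e e1 t X)
  have meet: "inf u d = a" if "a \<le> u" "\<not> d \<le> u" for u
    using covers_between[OF assms(1), of "inf u d"] that covers_le[OF assms(1)]
    by (metis inf.cobounded1 inf.cobounded2 inf_greatest)
  have e: "Delta e t = Delta a d"
    using Delta_D2[of e d] Cons.prems meet[of e] by simp
  have le: "e \<le> e1" "e1 \<le> t"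
    using Cons.hyps by (auto simp: covers_le cover_path_le)
  show ?case
  proof (cases "d \<le> e1")
    case True
    then have "e1 = t" using le Cons.prems by (intro order.antisym) simp_all
    then show ?thesis using Cons.hyps(2) e by (auto dest: cover_path_refl)
  next
    case False
    have t: "t = sup e1 d"
      using le Cons.prems by (intro order.antisym) (auto intro: le_supI1)
    have e1: "Delta e1 t = Delta a d"
      using Delta_D2[of e1 d] meet[of e1] le Cons.prems False t by simp
    have "absorb_eq X {#Delta a d#}"
      using Cons.IH le Cons.prems False t by simp
    then have "absorb_eq (add_mset (Delta e e1) X) {#Delta e e1, Delta a d#}"
      by (rule absorb_eq_add_mset)
    also have "absorb_eq {#Delta e e1, Delta a d#} {#Delta a d#}"
      using Delta_D1[OF le] e e1 by (intro absorb_eq_insert) simp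
    finally show ?thesis .
  qed
qed

lemma transpose_down:
  assumes "covers a d" "cover_path f c X" "c \<le> d" "\<not> c \<le> a" "f = inf a c"
  shows "absorb_eq X {#Delta a d#}"
  using assms(2-)
proof (induction rule: cover_path_rev_induct)
  case Nil
  then show ?case by (metis inf.cobounded1)
next
  case (Snoc u c X)
  have join: "sup a v = d" if "v \<le> d" "\<not> v \<le> a" for v
    using covers_between[OF assms(1), of "sup a v"] that covers_le[OF assms(1)]
    by (metis le_sup_iff order.refl sup_ge1)
  have c: "Delta f c = Delta a d"
    using Delta_D2[of a c] Snoc.prems join[of c] by simp
  have le: "f \<le> u" "u \<le> c"
    using Snoc.hyps by (auto simp: covers_le cover_path_le)
  show ?case
  proof (cases "u \<le> a")
    case True
    then have "f = u" using le Snoc.prems by (intro order.antisym) simp_all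
    then show ?thesis using Snoc.hyps(1) c by (auto dest: cover_path_refl)
  next
    case False
    have f: "f = inf a u"
      using le Snoc.prems by (intro order.antisym) (auto intro: le_infI2)
    have u: "Delta f u = Delta a d"
      using Delta_D2[of a u] join[of u] le Snoc.prems False f by simp
    have "absorb_eq X {#Delta a d#}"
      using Snoc.IH le Snoc.prems False f by simp
    then have "absorb_eq (add_mset (Delta u c) X) {#Delta u c, Delta a d#}"
      by (rule absorb_eq_add_mset)
    also have "absorb_eq {#Delta u c, Delta a d#} {#Delta a d#}"
      using Delta_D1[OF le] c u by (intro absorb_eq_insert) (simp add: add.commute)
    finally show ?thesis .
  qed
qed

text \<open>The Jordan-Hoelder argument: if the two chains start with different covers \<open>c\<close> and \<open>d\<close> of \<open>a\<close>,
  both are compared with chains through \<open>c \<squnion> d\<close>, where \<open>transpose_up\<close> identifies the part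
  from \<open>c\<close> to \<open>c \<squnion> d\<close> with the step from \<open>a\<close> to \<open>d\<close>, and vice versa.\<close>

lemma cover_path_unique:
  assumes bcf: "bcf TYPE('a::lattice)"
    and "cover_path (a :: 'a) b X" "cover_path a b Y"
  shows "absorb_eq X Y"
  using bcf_wf_up[OF bcf, of b] assms(2-)
proof (induction a arbitrary: X Y rule: wf_induct_rule)
  case (less a)
  show ?case
  proof (cases "a = b")
    case True
    then have "X = {#}" "Y = {#}" using less.prems cover_path_refl by metis+
    then show ?thesis by simp
  next
    case False
    obtain c X' where c: "covers a c" "cover_path c b X'" "X = add_mset (Delta a c) X'"
      using less.prems(1) False by cases auto
    obtain d Y' where d: "covers a d" "cover_path d b Y'" "Y = add_mset (Delta a d) Y'"
      using less.prems(2) False by cases auto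
    have b: "c \<le> b" "d \<le> b" using c(2) d(2) by (blast dest: cover_path_le)+
    have IH: "absorb_eq U V" if "covers a u" "cover_path u b U" "cover_path u b V" for u U V
      using less.IH[of u U V] that covers_less[OF that(1)] cover_path_le[OF that(2)] by simp
    show ?thesis
    proof (cases "c = d")
      case True
      then show ?thesis
        using IH[OF c(1,2)] d(2) unfolding c(3) d(3) by (metis absorb_eq_add_mset)
    next
      case False
      have nle: "\<not> d \<le> c" "\<not> c \<le> d"
        using False covers_between[OF c(1), of d] covers_between[OF d(1), of c]
          covers_less[OF c(1)] covers_less[OF d(1)] by (auto simp: less_le)
      obtain U where U: "cover_path c (sup c d) U"
        using cover_path_exists[OF bcf sup_ge1] by blast
      obtain V where V: "cover_path d (sup c d) V"
        using cover_path_exists[OF bcf sup_ge2] by blast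
      obtain Z where Z: "cover_path (sup c d) b Z"
        using cover_path_exists[OF bcf sup_least[OF b]] by blast
      have U': "absorb_eq U {#Delta a d#}"
        using transpose_up[OF d(1) U] nle c by (simp add: covers_le)
      have V': "absorb_eq V {#Delta a c#}"
        using transpose_up[OF c(1) V] nle d by (simp add: covers_le sup.commute)
      have "absorb_eq X' (U + Z)"
        using IH[OF c(1,2) cover_path_append[OF U Z]] .
      also have "absorb_eq (U + Z) ({#Delta a d#} + Z)"
        using U' by (intro absorb_eq_add) auto
      finally have X: "absorb_eq X (add_mset (Delta a c) ({#Delta a d#} + Z))"
        unfolding c(3) by (rule absorb_eq_add_mset)
      have "absorb_eq Y' (V + Z)"
        using IH[OF d(1,2) cover_path_append[OF V Z]] .
      also have "absorb_eq (V + Z) ({#Delta a c#} + Z)"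
        using V' by (intro absorb_eq_add) auto
      finally have Y: "absorb_eq Y (add_mset (Delta a d) ({#Delta a c#} + Z))"
        unfolding d(3) by (rule absorb_eq_add_mset)
      have "absorb_eq X (add_mset (Delta a d) ({#Delta a c#} + Z))"
        using X by (simp add: add_mset_commute)
      then show ?thesis using absorb_eq_sym[OF Y] by (rule absorb_eq_trans)
    qed
  qed
qed

text \<open>Relation (D2). By \<open>cover_path_unique\<close> both chains may be chosen freely. The chain in
  \<open>[a \<sqinter> b, b]\<close> is made to start with some cover \<open>b1\<close>, and the one in \<open>[a, a \<squnion> b]\<close> with a cover
  \<open>a1\<close> below \<open>a \<squnion> b1\<close>. If \<open>a1 \<sqinter> b\<close> is larger than \<open>a \<sqinter> b\<close>, the step \<open>[a, a1]\<close> transposes down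
  to \<open>[a \<sqinter> b, a1 \<sqinter> b]\<close>. Otherwise this step has no counterpart in the other chain and must be
  absorbed by one of the steps there; the choice of \<open>a1\<close> makes \<open>[a \<sqinter> b, b1]\<close> such a step.
  In both cases the induction continues with \<open>a1\<close> and \<open>b\<close>, whose join is still \<open>a \<squnion> b\<close>.\<close>

lemma cover_path_transpose:
  assumes bcf: "bcf TYPE('a::lattice)"
    and "cover_path (a :: 'a) (sup a b) X" "cover_path (inf a b) b Y"
  shows "absorb_eq X Y"
proof -
  have "absorb_eq X Y"
    if "t = sup a b" "cover_path a t X" "cover_path (inf a b) b Y" for t
    using bcf_wf_up[OF bcf, of t] that
  proof (induction a arbitrary: X Y rule: wf_induct_rule)
    case (less a)
    show ?case
    proof (cases "b \<le> a")
      case True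
      then have "sup a b = a" "inf a b = b"
        by (simp_all add: sup.absorb1 inf.absorb2)
      then have "X = {#}" "Y = {#}"
        using less.prems cover_path_refl by metis+
      then show ?thesis by simp
    next
      case False
      have "inf a b < b" using False by (metis inf.cobounded1 inf.cobounded2 order.order_iff_strict)
      then obtain b1 where b1: "covers (inf a b) b1" "b1 \<le> b"
        using bcf_cover_exists[OF bcf] by blast
      have nle: "\<not> b1 \<le> a"
        using b1 by (metis covers_less inf_greatest leD)
      have "a < sup a b1" using nle by (metis sup_ge1 sup_ge2 order.order_iff_strict)
      then obtain a1 where a1: "covers a a1" "a1 \<le> sup a b1"
        using bcf_cover_exists[OF bcf] by blast
      have "sup a b1 \<le> t"
        unfolding less.prems(1) using b1(2) by (rule sup_mono[OF order.refl])
      then have t_ge: "a1 \<le> t" using a1(2) by (rule order.trans[rotated])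
      have t_eq: "t = sup a1 b"
      proof (rule order.antisym)
        show "t \<le> sup a1 b"
          unfolding less.prems(1) using covers_le[OF a1(1)] by (rule sup_mono[OF _ order.refl])
        show "sup a1 b \<le> t"
          using t_ge less.prems(1) by (intro sup_least) simp_all
      qed
      obtain X1 where X1: "cover_path a1 t X1"
        using cover_path_exists[OF bcf t_ge] by blast
      have X: "absorb_eq X ({#Delta a a1#} + X1)"
        using cover_path_unique[OF bcf less.prems(2)] cover_path.Cons[OF a1(1) X1] by simp
      have IH: "absorb_eq X1 V" if "cover_path (inf a1 b) b V" for V
      proof (rule less.IH[of a1])
        show "(a1, a) \<in> {(x, y). y < x \<and> x \<le> t}"
          using covers_less[OF a1(1)] t_ge by simp
      qed (fact t_eq X1 that)+
      show ?thesis
      proof (cases "inf a1 b = inf a b")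
        case True
        have "absorb_eq X1 Y" using IH less.prems(3) True by simp
        then have X': "absorb_eq X ({#Delta a a1#} + Y)"
          using absorb_eq_trans[OF X absorb_eq_add[OF absorb_eq_refl]] by blast
        obtain Y1 where Y1: "cover_path b1 b Y1"
          using cover_path_exists[OF bcf b1(2)] by blast
        have Y: "absorb_eq Y (add_mset (Delta (inf a b) b1) Y1)"
          using cover_path_unique[OF bcf less.prems(3)] cover_path.Cons[OF b1(1) Y1] by simp
        \<comment> \<open>Both \<open>[a, a \<squnion> b1]\<close> and \<open>[a1, a \<squnion> b1]\<close> transpose down to \<open>[a \<sqinter> b, b1]\<close>.\<close>
        have meet: "inf u b1 = inf a b" if "inf u b = inf a b" for u
        proof -
          have "inf u b1 = inf (inf u b) b1" using b1(2) by (simp add: inf.assoc inf.absorb2)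
          also have "\<dots> = inf a b"
            unfolding that using covers_le[OF b1(1)] by (rule inf.absorb1)
          finally show ?thesis .
        qed
        have join: "sup a1 b1 = sup a b1"
        proof (rule order.antisym)
          show "sup a1 b1 \<le> sup a b1" using a1(2) by (intro sup_least) simp_all
          show "sup a b1 \<le> sup a1 b1"
            using covers_le[OF a1(1)] by (rule sup_mono[OF _ order.refl])
        qed
        have "Delta (inf a b) b1 = Delta a (sup a b1)"
          using Delta_D2[of a b1] meet[OF refl] by simp
        also have "\<dots> = Delta a a1 + Delta a1 (sup a1 b1)"
          using Delta_D1[OF covers_le[OF a1(1)] a1(2)] join by simp
        also have "\<dots> = Delta a a1 + Delta (inf a b) b1"
          using Delta_D2[of a1 b1] meet[OF True] by simp
        finally have absorb: "Delta a a1 + Delta (inf a b) b1 = Delta (inf a b) b1" by simp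
        have "absorb_eq ({#Delta a a1#} + Y) (add_mset (Delta a a1) (add_mset (Delta (inf a b) b1) Y1))"
          using absorb_eq_add_mset[OF Y] by simp
        also have "absorb_eq \<dots> (add_mset (Delta (inf a b) b1) Y1)"
          by (rule absorb_eq_insert[OF absorb])
        finally show ?thesis
          using absorb_eq_trans[OF X'] absorb_eq_trans absorb_eq_sym[OF Y] by blast
      next
        case False
        have le: "inf a b \<le> inf a1 b" using covers_le[OF a1(1)] by (simp add: le_infI1)
        have n: "\<not> inf a1 b \<le> a"
          using False le by (metis inf.cobounded2 inf_greatest order.antisym)
        have f: "inf a b = inf a (inf a1 b)"
          using covers_le[OF a1(1)] by (metis inf.absorb1 inf.assoc)
        obtain U where U: "cover_path (inf a b) (inf a1 b) U"
          using cover_path_exists[OF bcf le] by blast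
        obtain V where V: "cover_path (inf a1 b) b V"
          using cover_path_exists[OF bcf, of "inf a1 b" b] by auto
        have "absorb_eq U {#Delta a a1#}"
          using transpose_down[OF a1(1) U _ n f] by simp
        then have "absorb_eq ({#Delta a a1#} + X1) (U + V)"
          by (rule absorb_eq_add[OF absorb_eq_sym IH[OF V]])
        also have "absorb_eq (U + V) Y"
          using cover_path_unique[OF bcf cover_path_append[OF U V] less.prems(3)] .
        finally show ?thesis by (rule absorb_eq_trans[OF X])
      qed
    qed
  qed
  then show ?thesis using assms(2,3) by blast
qed

section \<open>The dimension monoid is presented by absorptions between covering pairs\<close>

definition chosen_path :: "'a::lattice \<Rightarrow> 'a \<Rightarrow> 'a dim multiset" where
  "chosen_path a b = (SOME X. cover_path a b X)"

definition steps_of :: "'a::lattice interval multiset \<Rightarrow> 'a dim multiset" where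
  "steps_of X = (\<Sum>i\<in>#X. chosen_path (lower i) (upper i))"

lemma steps_of_union: "steps_of (X + Y) = steps_of X + steps_of Y"
  by (simp add: steps_of_def)

lemma steps_of_Interval: "a \<le> b \<Longrightarrow> steps_of {#Interval (a, b)#} = chosen_path a b"
  by (simp add: steps_of_def lower.rep_eq upper.rep_eq Interval_inverse)

lemma cover_path_chosen_path:
  assumes "bcf TYPE('a::lattice)" "(a :: 'a) \<le> b"
  shows "cover_path a b (chosen_path a b)"
  unfolding chosen_path_def using cover_path_exists[OF assms] by (rule someI_ex)

lemma dim_cong_steps:
  assumes bcf: "bcf TYPE('a::lattice)" and "dim_cong (X :: 'a interval multiset) Y"
  shows "absorb_eq (steps_of X) (steps_of Y)"
  using assms(2)
proof induction
  case (dim_cong_D0 a)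
  have "chosen_path a a = {#}"
    using cover_path_chosen_path[OF bcf, of a a] by (auto dest: cover_path_refl)
  then show ?case by (simp add: steps_of_Interval) (simp add: steps_of_def)
next
  case (dim_cong_D1 a b c)
  have "absorb_eq (chosen_path a c) (chosen_path a b + chosen_path b c)"
    using dim_cong_D1 cover_path_chosen_path[OF bcf]
    by (intro cover_path_unique[OF bcf, of a c] cover_path_append[of a b]) auto
  then show ?case
    using dim_cong_D1 order.trans[of a b c] by (simp only: steps_of_union steps_of_Interval)
next
  case (dim_cong_D2 a b)
  have "absorb_eq (chosen_path a (sup a b)) (chosen_path (inf a b) b)"
    using cover_path_transpose[OF bcf] cover_path_chosen_path[OF bcf] by (meson inf_le2 sup_ge1)
  then show ?case by (simp add: steps_of_Interval)
next
  case (dim_cong_trans X Y Z)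
  show ?case using dim_cong_trans.IH by (rule absorb_eq_trans)
qed (auto simp: steps_of_union intro: absorb_eq_sym absorb_eq_add)

lemma abs_dim_steps:
  assumes bcf: "bcf TYPE('a::lattice)"
  shows "abs_dim X = \<Sum>\<^sub># (steps_of (X :: 'a interval multiset))"
    and "set_mset (steps_of X) \<subseteq> {Delta a b |a b. covers a b}"
proof (induction X)
  case empty
  show "abs_dim {#} = \<Sum>\<^sub># (steps_of ({#} :: 'a interval multiset))"
    and "set_mset (steps_of {#}) \<subseteq> {Delta a b |(a :: 'a) b. covers a b}"
    by (simp_all add: steps_of_def zero_dim_def)
next
  case (add i X)
  have i: "i = Interval (lower i, upper i)"
    by (simp add: lower.rep_eq upper.rep_eq bounds_of_interval_inverse)
  have path: "cover_path (lower i) (upper i) (chosen_path (lower i) (upper i))"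
    by (intro cover_path_chosen_path[OF bcf] lower_le_upper)
  have split: "steps_of (add_mset i X) = chosen_path (lower i) (upper i) + steps_of X"
    by (simp add: steps_of_def)
  have "Delta (lower i) (upper i) = abs_dim {#i#}"
    by (simp add: Delta.abs_eq flip: i)
  then have "abs_dim (add_mset i X) = Delta (lower i) (upper i) + abs_dim X"
    by (simp add: plus_dim.abs_eq)
  then show "abs_dim (add_mset i X) = \<Sum>\<^sub># (steps_of (add_mset i X))"
    using add.IH(1) cover_path_sum[OF path] by (simp add: split)
  show "set_mset (steps_of (add_mset i X)) \<subseteq> {Delta a b |a b. covers a b}"
    using add.IH(2) cover_path_steps[OF path] by (simp add: split)
qed

text \<open>A multiset of generators comes from a multiset of covering pairs. For such intervals the
  maximal chain is a single step, so \<open>steps_of\<close> gives back the generators up to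
  \<open>absorb_eq\<close>.\<close>

lemma covering_intervals_exist:
  assumes bcf: "bcf TYPE('a::lattice)"
    and "set_mset (X :: 'a dim multiset) \<subseteq> {Delta a b |a b. covers a b}"
  shows "\<exists>I. absorb_eq (steps_of I) X"
  using assms(2)
proof (induction X)
  case empty
  have "steps_of {#} = {#}" by (simp add: steps_of_def)
  then show ?case by (metis absorb_eq_refl)
next
  case (add x X)
  then obtain I where I: "absorb_eq (steps_of I) X" by auto
  obtain a b where ab: "x = Delta a b" "covers a b" using add.prems by auto
  have "absorb_eq (chosen_path a b) {#x#}"
    using cover_path_unique[OF bcf cover_path_chosen_path[OF bcf] cover_path_single] ab
    by (simp add: covers_le)
  then have "absorb_eq (steps_of ({#Interval (a, b)#} + I)) ({#x#} + X)"
    using I ab(2) absorb_eq_add by (simp only: steps_of_union steps_of_Interval covers_le)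
  then show ?case by auto
qed

theorem corollary7p8:
  assumes "bcf TYPE('a::lattice)"
  shows "primitive_monoid TYPE('a dim)"
proof (rule primitive_monoid_if_absorption_presented)
  let ?S = "{Delta a b |(a :: 'a) b. covers a b}"
  show "\<exists>X. set_mset X \<subseteq> ?S \<and> x = \<Sum>\<^sub># X" for x :: "'a dim"
  proof (induction x)
    case (1 X)
    show ?case using abs_dim_steps[OF assms, of X] by blast
  qed
  show "absorb_eq X Y"
    if S: "set_mset X \<subseteq> ?S" "set_mset Y \<subseteq> ?S" and sum: "\<Sum>\<^sub># X = \<Sum>\<^sub># Y"
    for X Y :: "'a dim multiset"
  proof -
    obtain I where I: "absorb_eq (steps_of I) X"
      using covering_intervals_exist[OF assms S(1)] by blast
    obtain J where J: "absorb_eq (steps_of J) Y"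
      using covering_intervals_exist[OF assms S(2)] by blast
    have "abs_dim I = \<Sum>\<^sub># X"
      using abs_dim_steps(1)[OF assms] absorb_eq_sum[OF I] by (rule trans)
    moreover have "abs_dim J = \<Sum>\<^sub># Y"
      using abs_dim_steps(1)[OF assms] absorb_eq_sum[OF J] by (rule trans)
    ultimately have "dim_cong I J"
      using sum by (simp flip: dim.abs_eq_iff)
    then have "absorb_eq (steps_of I) (steps_of J)"
      by (rule dim_cong_steps[OF assms])
    then have "absorb_eq (steps_of I) Y"
      using J by (rule absorb_eq_trans)
    with absorb_eq_sym[OF I] show ?thesis
      by (rule absorb_eq_trans)
  qed
qed

end
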